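(* Let $L_n=P_n\,\square\, K_2$. For every integer $n\ge 6$, $$D(L_n,x)=x(x+2)D(L_{n-1},x)+x(x+1)D(L_{n-2},x)+x^2(x+1)D(L_{n-3},x)-x^3D(L_{n-4},x)-x^3D(L_{n-5},x).$$
   Context: A set $S\subseteq V(G)$ is dominating in a finite simple graph $G$ if every vertex of $G$ is in $S$ or adjacent to a vertex of $S$. The domination polynomial is $D(G,x)=\sum_{i=0}^{|V(G)|} d_i(G)x^i$, where $d_i(G)$ is the number of dominating sets of $G$ of size $i$. The Cartesian product $G\,\square\, H$ has vertex set $V(G)\times V(H)$, with $(u_1,v_1)$ and $(u_2,v_2)$ adjacent iff either $u_1=u_2$ and $v_1v_2\in E(H)$, or $u_1u_2\in E(G)$ and $v_1=v_2$. $P_n$ is the path graph with $n$ vertices and $K_r$ is the complete graph on $r$ vertices. *)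

theory Defs
  imports "Graph_Theory.Kuratowski" "HOL-Computational_Algebra.Polynomial"
begin

text \<open>
  A finite simple graph is a \<^typ>\<open>'a pair_pre_digraph\<close> satisfying \<^const>\<open>pair_graph\<close> (finite,
  symmetric, loop-free): an undirected edge \<open>uv\<close> is represented by the two arcs \<open>(u, v)\<close> and
  \<open>(v, u)\<close>.
\<close>

definition dominating_set :: "'a pair_pre_digraph \<Rightarrow> 'a set \<Rightarrow> bool" where
  "dominating_set G S \<longleftrightarrow>
     S \<subseteq> pverts G \<and> (\<forall>v\<in>pverts G. v \<in> S \<or> (\<exists>u\<in>S. (v, u) \<in> parcs G))"

definition num_dominating_sets :: "'a pair_pre_digraph \<Rightarrow> nat \<Rightarrow> nat" where
  "num_dominating_sets G i = card {S. dominating_set G S \<and> card S = i}"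

definition domination_poly :: "'a pair_pre_digraph \<Rightarrow> int poly" where
  "domination_poly G = (\<Sum>i = 0..card (pverts G). monom (int (num_dominating_sets G i)) i)"

definition cartesian_product ::
    "'a pair_pre_digraph \<Rightarrow> 'b pair_pre_digraph \<Rightarrow> ('a \<times> 'b) pair_pre_digraph"
    (infixl \<open>\<box>\<close> 70) where
  "G \<box> H = \<lparr> pverts = pverts G \<times> pverts H,
     parcs = {((u\<^sub>1, v\<^sub>1), (u\<^sub>2, v\<^sub>2)).
       (u\<^sub>1 \<in> pverts G \<and> u\<^sub>1 = u\<^sub>2 \<and> (v\<^sub>1, v\<^sub>2) \<in> parcs H) \<or>
       ((u\<^sub>1, u\<^sub>2) \<in> parcs G \<and> v\<^sub>1 \<in> pverts H \<and> v\<^sub>1 = v\<^sub>2)} \<rparr>"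

definition path_graph :: "nat \<Rightarrow> nat pair_pre_digraph" where
  "path_graph n = \<lparr> pverts = {..<n},
     parcs = {(i, j). i < n \<and> j < n \<and> (j = i + 1 \<or> i = j + 1)} \<rparr>"

definition complete_graph :: "nat \<Rightarrow> nat pair_pre_digraph" where
  "complete_graph r = \<lparr> pverts = {..<r}, parcs = {(i, j). i < r \<and> j < r \<and> i \<noteq> j} \<rparr>"

definition ladder :: "nat \<Rightarrow> (nat \<times> nat) pair_pre_digraph" where
  "ladder n = path_graph n \<box> complete_graph 2"

abbreviation poly_var :: "int poly" (\<open>\<X>\<close>) where
  "\<X> \<equiv> [:0, 1:]"

lemma pair_graph_path_graph: "pair_graph (path_graph n)"
proof -
  have "parcs (path_graph n) \<subseteq> {..<n} \<times> {..<n}"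
    by (auto simp: path_graph_def)
  then have "finite (parcs (path_graph n))"
    by (rule finite_subset) simp
  then show ?thesis
    by unfold_locales (auto simp: path_graph_def symmetric_def intro: symI)
qed

lemma complete_digraph_complete_graph: "K\<^bsub>r\<^esub> (with_proj (complete_graph r))"
  by (auto simp: complete_digraph_pair_def complete_graph_def)

lemma pair_graph_complete_graph: "pair_graph (complete_graph r)"
proof -
  have "parcs (complete_graph r) \<subseteq> {..<r} \<times> {..<r}"
    by (auto simp: complete_graph_def)
  then have "finite (parcs (complete_graph r))"
    by (rule finite_subset) simp
  then show ?thesis
    by unfold_locales (auto simp: complete_graph_def symmetric_def intro: symI)
qed

lemma pair_graph_cartesian_product:
  assumes "pair_graph G" "pair_graph H"
  shows "pair_graph (G \<box> H)"
proof -
  interpret G: pair_graph G by fact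
  interpret H: pair_graph H by fact
  have verts: "pverts (G \<box> H) = pverts G \<times> pverts H"
    by (simp add: cartesian_product_def)
  have sub: "parcs (G \<box> H) \<subseteq> (pverts G \<times> pverts H) \<times> (pverts G \<times> pverts H)"
    by (auto simp: cartesian_product_def dest: G.in_arcsD1 G.in_arcsD2 H.in_arcsD1 H.in_arcsD2)
  have fin: "finite (pverts G \<times> pverts H)"
    using G.pair_finite_verts H.pair_finite_verts by simp
  have sym: "sym (parcs G)" "sym (parcs H)"
    using G.pair_sym_arcs H.pair_sym_arcs by (simp_all add: symmetric_def)
  have "sym (parcs (G \<box> H))"
    by (rule symI) (auto simp: cartesian_product_def dest: symD[OF sym(1)] symD[OF sym(2)])
  moreover have "finite (parcs (G \<box> H))"
    using sub fin by (meson finite_SigmaI finite_subset)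
  moreover have "fst e \<noteq> snd e" if "e \<in> parcs (G \<box> H)" for e
    using that G.pair_no_loops H.pair_no_loops by (fastforce simp: cartesian_product_def)
  moreover have "fst e \<in> pverts (G \<box> H)" "snd e \<in> pverts (G \<box> H)"
    if "e \<in> parcs (G \<box> H)" for e
    using subsetD[OF sub that] by (auto simp: verts)
  moreover have "finite (pverts (G \<box> H))"
    using fin by (simp add: verts)
  ultimately show ?thesis
    by unfold_locales (simp_all add: symmetric_def)
qed

lemma pair_graph_ladder: "pair_graph (ladder n)"
  unfolding ladder_def
  by (intro pair_graph_cartesian_product pair_graph_path_graph pair_graph_complete_graph)

end

theory Submission
  imports Defs
begin

text \<open>
  The proof is a transfer-matrix computation. A vertex set of the ladder is a sequence of columns,
  each a subset of the two rows. A vertex has its neighbours in its own column and, in its own row,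
  in the two adjacent columns; hence domination is a condition on triples of consecutive columns:
  a non-empty column is dominated from within, and an empty column is dominated iff its two
  neighbouring columns together meet both rows (\<open>covered\<close>). Cutting the ladder after one of its
  columns therefore leaves only two things to remember: that last column \<open>c\<close>, and the column \<open>r\<close>
  that is promised to follow it. The weighted counts \<open>weight n c r\<close> of the vertex sets that are
  dominated under this promise satisfy a linear recursion in the number of columns
  (\<open>weight_Suc\<close>).

  The promise \<open>r\<close> matters only for \<open>c = {}\<close>, and sums over the two rows may be formed because the
  rows play symmetric parts. This leaves five sequences \<open>A\<close>, \<open>B\<close>, \<open>C\<close>, \<open>Q\<close>, \<open>R\<close>, which satisfy a
  closed linear system, and \<open>A + B + C\<close> is the domination polynomial. By the Cayley--Hamilton
  theorem every linear functional of such a system satisfies the recurrence given by the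
  characteristic polynomial of its \<open>5 \<times> 5\<close> matrix, which is
  \[ t^5 - x(x+2)t^4 - x(x+1)t^3 - x^2(x+1)t^2 + x^3 t + x^3 . \]
  The theorem is this recurrence (\<open>linear_system_recurrence\<close>); it is verified directly, by writing
  all six values in terms of the five sequences at the smallest index.
\<close>

section \<open>The domination polynomial as a sum over dominating sets\<close>

lemma domination_poly_eq_sum:
  assumes "finite (pverts G)"
  shows "domination_poly G = (\<Sum>S | dominating_set G S. \<X> ^ card S)"
proof -
  let ?D = "{S. dominating_set G S}"
  have sub: "?D \<subseteq> Pow (pverts G)"
    by (auto simp: dominating_set_def)
  then have fin: "finite ?D"
    using assms by (meson finite_Pow_iff finite_subset)
  have card_range: "card ` ?D \<subseteq> {0..card (pverts G)}"
    using assms by (auto simp: dominating_set_def intro!: card_mono)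
  have monom_X: "monom (1 :: int) i = \<X> ^ i" for i
    by (simp add: monom_altdef)
  have "monom (int (num_dominating_sets G i)) i = (\<Sum>S\<in>{S \<in> ?D. card S = i}. \<X> ^ card S)" for i
  proof -
    have "(\<Sum>S\<in>{S \<in> ?D. card S = i}. \<X> ^ card S) = (\<Sum>S\<in>{S \<in> ?D. card S = i}. monom 1 i)"
      by (intro sum.cong) (auto simp: monom_X)
    also have "\<dots> = monom (int (num_dominating_sets G i)) i"
      by (simp add: num_dominating_sets_def monom_altdef of_nat_poly)
    finally show ?thesis ..
  qed
  then have "domination_poly G
      = (\<Sum>i\<in>{0..card (pverts G)}. \<Sum>S\<in>{S \<in> ?D. card S = i}. \<X> ^ card S)"
    by (simp add: domination_poly_def)
  also have "\<dots> = (\<Sum>S\<in>?D. \<X> ^ card S)"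
    using fin card_range by (intro sum.group) auto
  finally show ?thesis .
qed

section \<open>Domination in ladders, column by column\<close>

definition column :: "(nat \<times> nat) set \<Rightarrow> nat \<Rightarrow> nat set" where
  "column S i = S `` {i}"

definition covered :: "nat set \<Rightarrow> nat set \<Rightarrow> nat set \<Rightarrow> bool" where
  "covered l c r \<longleftrightarrow> c \<noteq> {} \<or> l \<union> r = {0, 1}"

text \<open>
  There is no column to the left of column \<open>0\<close>; since \<open>0 - 1 = 0\<close> on the natural numbers, it has to
  be replaced by the empty column explicitly.
\<close>

definition left_column :: "(nat \<times> nat) set \<Rightarrow> nat \<Rightarrow> nat set" where
  "left_column S i = (if i = 0 then {} else column S (i - 1))"

definition partial_sets :: "nat \<Rightarrow> nat set \<Rightarrow> nat set \<Rightarrow> (nat \<times> nat) set set" where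
  "partial_sets n c r = {S. S \<subseteq> {..n} \<times> {0, 1} \<and> column S n = c \<and>
     (\<forall>i\<le>n. covered (left_column S i) (column S i) (if i = n then r else column S (Suc i)))}"

definition weight :: "nat \<Rightarrow> nat set \<Rightarrow> nat set \<Rightarrow> int poly" where
  "weight n c r = (\<Sum>S\<in>partial_sets n c r. \<X> ^ card S)"

lemma lessThan_2: "{..<2 :: nat} = {0, 1}"
  by auto

lemma finite_partial_sets: "finite (partial_sets n c r)"
  by (rule finite_subset[of _ "Pow ({..n} \<times> {0, 1})"]) (auto simp: partial_sets_def)

lemma pverts_ladder: "pverts (ladder n) = {..<n} \<times> {0, 1}"
  by (simp add: ladder_def cartesian_product_def path_graph_def complete_graph_def lessThan_2)

lemma parcs_ladder:
  "((i, a), (j, b)) \<in> parcs (ladder n) \<longleftrightarrow>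
     i < n \<and> j < n \<and> a < 2 \<and> b < 2 \<and> (i = j \<and> a \<noteq> b \<or> (j = i + 1 \<or> i = j + 1) \<and> a = b)"
  by (auto simp: ladder_def cartesian_product_def path_graph_def complete_graph_def)

text \<open>
  A complete ladder is a partial one whose last column is followed by the empty column.
\<close>

lemma dominating_ladder_iff:
  "dominating_set (ladder (Suc n)) S \<longleftrightarrow> (\<exists>c\<in>Pow {0, 1}. S \<in> partial_sets n c {})"
proof (cases "S \<subseteq> {..n} \<times> {0, 1}")
  case True
  let ?dom = "\<lambda>v. v \<in> S \<or> (\<exists>u\<in>S. (v, u) \<in> parcs (ladder (Suc n)))"
  have row_iff: "?dom (i, a) \<longleftrightarrow> column S i \<noteq> {} \<or>
      a \<in> left_column S i \<union> (if i = n then {} else column S (Suc i))"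
    if i: "i \<le> n" and a: "a \<in> {0, 1}" for i a
  proof
    assume "?dom (i, a)"
    then show "column S i \<noteq> {} \<or>
        a \<in> left_column S i \<union> (if i = n then {} else column S (Suc i))"
      using True by (fastforce simp: parcs_ladder column_def left_column_def)
  next
    assume "column S i \<noteq> {} \<or> a \<in> left_column S i \<union> (if i = n then {} else column S (Suc i))"
    then consider "column S i \<noteq> {}" | "a \<in> left_column S i" | "i < n" "a \<in> column S (Suc i)"
      using i by (cases "i = n") auto
    then show "?dom (i, a)"
    proof cases
      case 1
      then obtain b where b: "(i, b) \<in> S"
        by (auto simp: column_def)
      show ?thesis
      proof (cases "a = b")
        case False
        have "((i, a), (i, b)) \<in> parcs (ladder (Suc n))"
          using i a False b True by (auto simp: parcs_ladder)
        then show ?thesis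
          using b by blast
      qed (use b in simp)
    next
      case 2
      then have "(i - 1, a) \<in> S" "i > 0"
        by (auto simp: left_column_def column_def split: if_splits)
      moreover from this have "((i, a), (i - 1, a)) \<in> parcs (ladder (Suc n))"
        using i a by (auto simp: parcs_ladder)
      ultimately show ?thesis
        by blast
    next
      case 3
      then have "(Suc i, a) \<in> S"
        by (simp add: column_def)
      moreover have "((i, a), (Suc i, a)) \<in> parcs (ladder (Suc n))"
        using i a 3 by (auto simp: parcs_ladder)
      ultimately show ?thesis
        by blast
    qed
  qed
  have sub: "left_column S i \<union> (if i = n then {} else column S (Suc i)) \<subseteq> {0, 1}" for i
    using True by (auto simp: left_column_def column_def)
  have "dominating_set (ladder (Suc n)) S \<longleftrightarrow> (\<forall>i\<le>n. \<forall>a\<in>{0, 1}. ?dom (i, a))"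
    using True by (auto simp: dominating_set_def pverts_ladder less_Suc_eq_le)
  also have "\<dots> \<longleftrightarrow> (\<forall>i\<le>n. \<forall>a\<in>{0, 1}. column S i \<noteq> {} \<or>
      a \<in> left_column S i \<union> (if i = n then {} else column S (Suc i)))"
    using row_iff by blast
  also have "\<dots> \<longleftrightarrow> (\<forall>i\<le>n. covered (left_column S i) (column S i)
      (if i = n then {} else column S (Suc i)))"
    unfolding covered_def using sub by (intro all_cong) blast
  also have "\<dots> \<longleftrightarrow> (\<exists>c\<in>Pow {0, 1}. S \<in> partial_sets n c {})"
    using True by (auto simp: partial_sets_def column_def)
  finally show ?thesis .
next
  case False
  then show ?thesis
    by (auto simp: dominating_set_def partial_sets_def pverts_ladder lessThan_Suc_atMost)
qed

lemma domination_poly_ladder: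
  "domination_poly (ladder (Suc n)) = (\<Sum>c\<in>Pow {0, 1}. weight n c {})"
proof -
  have "{S. dominating_set (ladder (Suc n)) S} = (\<Union>c\<in>Pow {0, 1}. partial_sets n c {})"
    using dominating_ladder_iff by auto
  moreover have "(\<Sum>S\<in>(\<Union>c\<in>Pow {0, 1}. partial_sets n c {}). \<X> ^ card S)
      = (\<Sum>c\<in>Pow {0, 1}. weight n c {})"
    unfolding weight_def
    by (rule sum.UNION_disjoint) (auto simp: finite_partial_sets, auto simp: partial_sets_def)
  ultimately show ?thesis
    by (simp add: domination_poly_eq_sum pverts_ladder)
qed

section \<open>The transfer recursion\<close>

lemma partial_sets_Suc:
  assumes "c \<subseteq> {0, 1}"
  shows "partial_sets (Suc n) c r =
    (\<Union>l\<in>{l \<in> Pow {0, 1}. covered l c r}. (\<lambda>S. S \<union> {Suc n} \<times> c) ` partial_sets n l c)"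
    (is "?L = ?R")
proof (intro subset_antisym subsetI)
  fix S assume S: "S \<in> ?L"
  define T where "T = S \<inter> {..n} \<times> {0, 1}"
  have split: "S = T \<union> {Suc n} \<times> c"
  proof (rule set_eqI)
    fix v
    have "S \<subseteq> {..Suc n} \<times> {0, 1}" "c = S `` {Suc n}"
      using S by (auto simp: partial_sets_def column_def)
    then show "v \<in> S \<longleftrightarrow> v \<in> T \<union> {Suc n} \<times> c"
      by (cases v) (auto simp: T_def le_Suc_eq)
  qed
  have col: "column T i = column S i" if "i \<le> n" for i
    using S that by (auto simp: T_def partial_sets_def column_def)
  have left: "left_column T i = left_column S i" if "i \<le> n" for i
    using that by (simp add: left_column_def col)
  have cov: "covered (left_column S i) (column S i) (if i = Suc n then r else column S (Suc i))"
    if "i \<le> Suc n" for i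
    using S that by (auto simp: partial_sets_def)
  have colc: "column S (Suc n) = c"
    using S by (simp add: partial_sets_def)
  have "T \<in> partial_sets n (column T n) c"
    unfolding partial_sets_def
  proof (intro CollectI conjI allI impI)
    fix i assume i: "i \<le> n"
    show "covered (left_column T i) (column T i) (if i = n then c else column T (Suc i))"
      using cov[of i] i colc by (auto simp: col left split: if_splits)
  qed (auto simp: T_def)
  moreover have "column T n \<in> Pow {0, 1}"
    by (auto simp: T_def column_def)
  moreover have "covered (column T n) c r"
    using cov[of "Suc n"] by (simp add: colc left_column_def col)
  ultimately show "S \<in> ?R"
    using split by blast
next
  fix S assume "S \<in> ?R"
  then obtain l T where cov: "covered l c r" and T: "T \<in> partial_sets n l c"
    and S: "S = T \<union> {Suc n} \<times> c" by blast
  have sub: "T \<subseteq> {..n} \<times> {0, 1}"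
    using T by (simp add: partial_sets_def)
  have col: "column S i = column T i" if "i \<le> n" for i
    using that by (auto simp: S column_def)
  have left: "left_column S i = left_column T i" if "i \<le> n" for i
    using that by (simp add: left_column_def col)
  have colc: "column S (Suc n) = c"
    using sub by (auto simp: S column_def)
  have "covered (left_column S i) (column S i) (if i = Suc n then r else column S (Suc i))"
    if "i \<le> Suc n" for i
  proof (cases "i = Suc n")
    case True
    then show ?thesis
      using cov T by (simp add: colc left_column_def col partial_sets_def)
  next
    case False
    with that have i: "i \<le> n" by simp
    then have "covered (left_column T i) (column T i) (if i = n then c else column T (Suc i))"
      using T by (simp add: partial_sets_def)
    then show ?thesis
      using i by (cases "i = n") (simp_all add: col left colc)
  qed
  moreover have "S \<subseteq> {..Suc n} \<times> {0, 1}"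
    using sub assms by (auto simp: S)
  ultimately show "S \<in> ?L"
    using colc by (simp add: partial_sets_def)
qed

text \<open>
  The last column \<open>l\<close> of the shorter ladder is promised the successor \<open>c\<close>, which settles all columns
  up to \<open>l\<close>; the only new condition is that \<open>c\<close> itself is dominated.
\<close>

lemma weight_Suc:
  assumes c: "c \<subseteq> {0, 1}"
  shows "weight (Suc n) c r =
    \<X> ^ card c * (\<Sum>l\<in>Pow {0, 1}. if covered l c r then weight n l c else 0)"
proof -
  let ?add = "\<lambda>S :: (nat \<times> nat) set. S \<union> {Suc n} \<times> c"
  let ?I = "{l \<in> Pow {0, 1}. covered l c r}"
  have restrict: "?add S \<inter> {..n} \<times> {0, 1} = S" if "S \<in> partial_sets n l c" for S l
    using that by (auto simp: partial_sets_def)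
  have inj: "inj_on ?add (partial_sets n l c)" for l
    by (rule inj_on_inverseI[of _ "\<lambda>S. S \<inter> {..n} \<times> {0, 1}"]) (rule restrict)
  have disj: "?add ` partial_sets n l c \<inter> ?add ` partial_sets n l' c = {}" if "l \<noteq> l'" for l l'
  proof -
    have False if S: "S \<in> partial_sets n l c" "S' \<in> partial_sets n l' c" and "?add S = ?add S'"
      for S S'
    proof -
      have "S = S'"
        using restrict[OF S(1)] restrict[OF S(2)] \<open>?add S = ?add S'\<close> by metis
      then show False
        using S \<open>l \<noteq> l'\<close> by (simp add: partial_sets_def)
    qed
    then show ?thesis
      by blast
  qed
  have card_add: "card (?add S) = card c + card S" if "S \<in> partial_sets n l c" for S l
  proof -
    have S: "S \<subseteq> {..n} \<times> {0, 1}"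
      using that by (simp add: partial_sets_def)
    then have "finite S"
      by (rule finite_subset) simp
    moreover have "finite c"
      using c by (rule finite_subset) simp
    moreover have "S \<inter> {Suc n} \<times> c = {}"
      using S by auto
    ultimately show ?thesis
      by (simp add: card_Un_disjoint card_cartesian_product_singleton)
  qed
  have "weight (Suc n) c r = (\<Sum>l\<in>?I. \<Sum>S\<in>?add ` partial_sets n l c. \<X> ^ card S)"
    unfolding weight_def partial_sets_Suc[OF c]
    by (rule sum.UNION_disjoint) (use disj finite_partial_sets in auto)
  also have "\<dots> = (\<Sum>l\<in>?I. \<X> ^ card c * weight n l c)"
    by (intro sum.cong refl)
      (simp add: sum.reindex[OF inj] weight_def card_add power_add sum_distrib_left)
  also have "\<dots> = \<X> ^ card c * (\<Sum>l\<in>?I. weight n l c)"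
    by (simp add: sum_distrib_left)
  also have "(\<Sum>l\<in>?I. weight n l c) = (\<Sum>l\<in>Pow {0, 1}. if covered l c r then weight n l c else 0)"
    by (rule sum.inter_filter) simp
  finally show ?thesis .
qed

section \<open>A closed linear system of order five\<close>

lemma sum_Pow_rows:
  "(\<Sum>c\<in>Pow {0, 1 :: nat}. f c) = f {} + f {0} + f {1} + f {0, 1}" for f :: "nat set \<Rightarrow> int poly"
proof -
  have "Pow {0, 1 :: nat} = {{}, {0}, {1}, {0, 1}}"
    by (auto simp: Pow_insert)
  moreover have "{0} \<noteq> {1 :: nat}" "{0} \<noteq> {0, 1 :: nat}" "{1} \<noteq> {0, 1 :: nat}"
    by auto
  ultimately show ?thesis
    by (simp add: algebra_simps)
qed

lemma weight_nonempty:
  assumes "c \<noteq> {}"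
  shows "weight n c r = weight n c {}"
proof -
  have "covered (left_column S i) (column S i) (if i = n then r else column S (Suc i)) \<longleftrightarrow>
      covered (left_column S i) (column S i) (if i = n then {} else column S (Suc i))"
    if "column S n = c" for S i
    using that assms by (cases "i = n") (simp_all add: covered_def)
  then have "partial_sets n c r = partial_sets n c {}"
    unfolding partial_sets_def by blast
  then show ?thesis
    by (simp add: weight_def)
qed

text \<open>
  \<open>A\<close> and \<open>B\<close> collect the sets whose last column has two vertices or one vertex; by
  \<open>weight_nonempty\<close> the choice of promise there is immaterial. \<open>C\<close>, \<open>Q\<close> and \<open>R\<close> collect those whose
  last column is empty, when the promised next column has none, one or both of its vertices. A sum
  over the two rows suffices in \<open>B\<close> and \<open>Q\<close> because the recursion never separates the rows.
\<close>

definition A :: "nat \<Rightarrow> int poly" where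
  "A n = weight n {0, 1} {}"

definition B :: "nat \<Rightarrow> int poly" where
  "B n = weight n {0} {} + weight n {1} {}"

definition C :: "nat \<Rightarrow> int poly" where
  "C n = weight n {} {}"

definition Q :: "nat \<Rightarrow> int poly" where
  "Q n = weight n {} {0} + weight n {} {1}"

definition R :: "nat \<Rightarrow> int poly" where
  "R n = weight n {} {0, 1}"

lemma domination_poly_ladder_ABC: "domination_poly (ladder (Suc n)) = A n + B n + C n"
  by (simp only: domination_poly_ladder sum_Pow_rows A_def B_def C_def algebra_simps)

lemma A_Suc: "A (Suc n) = \<X>^2 * (A n + B n + R n)"
  using weight_nonempty[of "{0, 1}" n "{0, 1}"] weight_nonempty[of "{0}" n "{0, 1}"]
    weight_nonempty[of "{1}" n "{0, 1}"]
  by (simp add: A_def B_def R_def weight_Suc sum_Pow_rows covered_def power2_eq_square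
      algebra_simps del: One_nat_def)

lemma B_Suc: "B (Suc n) = \<X> * (2 * A n + 2 * B n + Q n)"
proof -
  have "weight (Suc n) {a} {} = \<X> * (A n + B n + weight n {} {a})" if "a \<in> {0, 1}" for a
    using that weight_nonempty[of "{0, 1}" n "{a}"] weight_nonempty[of "{0}" n "{a}"]
      weight_nonempty[of "{1}" n "{a}"]
    by (subst weight_Suc) (auto simp: A_def B_def sum_Pow_rows covered_def algebra_simps
        simp del: One_nat_def)
  from this[of 0] this[of 1] show ?thesis
    by (simp add: B_def Q_def algebra_simps del: One_nat_def)
qed

lemma C_Suc: "C (Suc n) = A n"
  by (simp add: A_def C_def weight_Suc sum_Pow_rows covered_def
      insert_commute[of 1 0] del: One_nat_def)

lemma Q_Suc: "Q (Suc n) = 2 * A n + B n"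
  by (simp add: A_def B_def Q_def weight_Suc sum_Pow_rows covered_def
      insert_commute[of 1 0] del: One_nat_def)

lemma R_Suc: "R (Suc n) = A n + B n + C n"
  by (simp add: A_def B_def C_def R_def weight_Suc sum_Pow_rows covered_def
      insert_commute[of 1 0] algebra_simps del: One_nat_def)

text \<open>
  This is Cayley--Hamilton for the system: the coefficients are those of the characteristic
  polynomial, so the recurrence holds for any initial values.
\<close>

lemma linear_system_recurrence:
  fixes x :: "'a :: comm_ring_1" and a b c q r :: "nat \<Rightarrow> 'a"
  assumes a: "\<And>n. a (Suc n) = x^2 * (a n + b n + r n)"
    and b: "\<And>n. b (Suc n) = x * (2 * a n + 2 * b n + q n)"
    and c: "\<And>n. c (Suc n) = a n"
    and q: "\<And>n. q (Suc n) = 2 * a n + b n"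
    and r: "\<And>n. r (Suc n) = a n + b n + c n"
  defines "d \<equiv> \<lambda>n. a n + b n + c n"
  shows "d (Suc (Suc (Suc (Suc (Suc n))))) =
      x * (x + 2) * d (Suc (Suc (Suc (Suc n)))) + x * (x + 1) * d (Suc (Suc (Suc n)))
    + x^2 * (x + 1) * d (Suc (Suc n)) - x^3 * d (Suc n) - x^3 * d n"
  unfolding d_def a b c q r
  by (simp add: algebra_simps power2_eq_square power3_eq_cube)

theorem theorem4p2:
  fixes n :: nat
  assumes "n \<ge> 6"
  shows "domination_poly (ladder n) =
      \<X> * (\<X> + 2) * domination_poly (ladder (n - 1))
    + \<X> * (\<X> + 1) * domination_poly (ladder (n - 2))
    + \<X>^2 * (\<X> + 1) * domination_poly (ladder (n - 3))
    - \<X>^3 * domination_poly (ladder (n - 4))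
    - \<X>^3 * domination_poly (ladder (n - 5))"
proof -
  from assms obtain m where "n = m + 6"
    by (metis add.commute le_Suc_ex)
  then have n: "n = Suc (Suc (Suc (Suc (Suc (Suc m)))))"
    by simp
  have shifts: "n - 1 = Suc (Suc (Suc (Suc (Suc m))))" "n - 2 = Suc (Suc (Suc (Suc m)))"
    "n - 3 = Suc (Suc (Suc m))" "n - 4 = Suc (Suc m)" "n - 5 = Suc m"
    by (simp_all add: n)
  show ?thesis
    unfolding shifts unfolding n domination_poly_ladder_ABC
    by (rule linear_system_recurrence[where a = A and b = B and c = C and q = Q and r = R])
      (rule A_Suc B_Suc C_Suc Q_Suc R_Suc)+
qed

end
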